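(* Let $n\ge3$. Let $K\in C([-1,1])$ be nonnegative and strictly increasing, and let $\kappa_1>0$ be its degree-one multiplier, i.e. $\int_{\mathbb S^{n-1}}K(z\cdot\omega)\,\omega\,d\mu(\omega)=\kappa_1z$ for all $z\in\mathbb S^{n-1}$. If $\gamma$ is a Borel probability measure on $\mathbb S^{n-1}_x\times\mathbb S^{n-1}_\omega$ with first marginal (in the variable $x$) equal to $\mu$, then $$\|\mathcal K\mathcal N_\gamma\|_{L^1(\mu)}\le\kappa_1 .$$ Equality holds if and only if there exists $M\in O(n)$ such that $$\gamma=(x,Mx)_\#\mu,$$ i.e. $\gamma$ is the push-forward of $\mu$ under the map $x\mapsto(x,Mx)$.
   Context: $\mathbb S^{n-1}$ is the unit sphere of $\mathbb R^n$ and $\mu$ is the normalized surface measure (a probability measure) on it. For a probability measure $\gamma$ on $\mathbb S^{n-1}_x\times\mathbb S^{n-1}_\omega$, $\mathcal N_\gamma$ is the $\mathbb R^n$-valued measure $\mathcal N_\gamma(E)=\int_{\mathbb S^{n-1}\times E}x\,d\gamma(x,\omega)$, and $$(\mathcal K\mathcal N_\gamma)(z)=\int_{\mathbb S^{n-1}}K(z\cdot\omega)\,d\mathcal N_\gamma(\omega)=\int K(z\cdot\omega)\,x\,d\gamma(x,\omega).$$ $\|F\|_{L^1(\mu)}=\int|F|\,d\mu$ with the Euclidean norm $|\cdot|$. *)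

theory Defs
  imports "HOL-Probability.Probability"
begin

abbreviation unit_sphere :: "'a::euclidean_space set" where
  "unit_sphere \<equiv> sphere 0 1"

abbreviation sphere_borel :: "'a::euclidean_space measure" where
  "sphere_borel \<equiv> restrict_space borel unit_sphere"

text \<open>
  The normalized surface measure is the radial projection of the uniform distribution on the
  unit ball: the surface measure of \<open>E\<close> is proportional to the volume of the cone over \<open>E\<close>
  inside the ball (see \<open>emeasure_sphere_measure\<close>). The origin, a null set, is removed so that
  the projection really maps into the sphere.
\<close>

definition sphere_measure :: "'a::euclidean_space measure" where
  "sphere_measure =
     distr (restrict_space (uniform_measure lborel (ball 0 1)) (- {0})) sphere_borel
       (\<lambda>x. x /\<^sub>R norm x)"

lemma space_sphere_measure [simp]: "space sphere_measure = unit_sphere"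
  by (simp add: sphere_measure_def space_restrict_space)

lemma sets_sphere_measure [simp, measurable_cong]: "sets sphere_measure = sets sphere_borel"
  by (simp add: sphere_measure_def)

lemma measurable_radial_projection:
  "(\<lambda>x::'a::euclidean_space. x /\<^sub>R norm x)
     \<in> restrict_space (uniform_measure lborel (ball 0 1)) (- {0}) \<rightarrow>\<^sub>M sphere_borel"
proof (rule measurable_restrict_space2)
  show "(\<lambda>x::'a. x /\<^sub>R norm x)
      \<in> space (restrict_space (uniform_measure lborel (ball 0 1)) (- {0})) \<rightarrow> unit_sphere"
    by (auto simp: space_restrict_space)
  show "(\<lambda>x::'a. x /\<^sub>R norm x)
      \<in> restrict_space (uniform_measure lborel (ball 0 1)) (- {0}) \<rightarrow>\<^sub>M borel"
    by (rule measurable_restrict_space1) measurable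
qed

lemma emeasure_sphere_measure:
  fixes E :: "'a::euclidean_space set"
  assumes "E \<in> sets borel" and "E \<subseteq> unit_sphere"
  shows "emeasure sphere_measure E =
    emeasure lborel {x \<in> ball 0 1 - {0}. x /\<^sub>R norm x \<in> E} / emeasure lborel (ball (0::'a) 1)"
proof -
  have E: "E \<in> sets (sphere_borel :: 'a measure)"
    using assms by (auto simp: sets_restrict_space_iff)
  let ?A = "{x::'a. x \<noteq> 0 \<and> x /\<^sub>R norm x \<in> E}"
  have A: "?A \<in> sets borel"
    using assms(1) by measurable
  have "emeasure sphere_measure E =
      emeasure (restrict_space (uniform_measure lborel (ball (0::'a) 1)) (- {0})) ?A"
    unfolding sphere_measure_def
    by (subst emeasure_distr[OF measurable_radial_projection E])
      (auto intro!: arg_cong2[where f = emeasure] simp: space_restrict_space)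
  also have "\<dots> = emeasure (uniform_measure lborel (ball (0::'a) 1)) ?A"
    by (rule emeasure_restrict_space) auto
  also have "\<dots> = emeasure lborel (ball (0::'a) 1 \<inter> ?A) / emeasure lborel (ball (0::'a) 1)"
    using A by (intro emeasure_uniform_measure) auto
  also have "ball 0 1 \<inter> ?A = {x \<in> ball 0 1 - {0}. x /\<^sub>R norm x \<in> E}"
    by auto
  finally show ?thesis .
qed

lemma prob_space_sphere_measure: "prob_space (sphere_measure :: 'a::euclidean_space measure)"
proof
  let ?B = "ball (0::'a) 1"
  have "{x \<in> ?B - {0}. x /\<^sub>R norm x \<in> unit_sphere} = ?B - {0}"
    by auto
  moreover have "emeasure lborel (?B - {0}) = emeasure lborel ?B"
    by (rule emeasure_Diff_null_set) auto
  moreover have "emeasure lborel ?B \<noteq> 0" "emeasure lborel ?B \<noteq> \<infinity>"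
    using emeasure_lborel_ball_finite[of "0::'a" 1] content_ball_pos[of 1 "0::'a"]
    by (auto simp: measure_def)
  ultimately show "emeasure (sphere_measure :: 'a measure) (space sphere_measure) = 1"
    by (simp add: emeasure_sphere_measure ennreal_divide_self less_top)
qed

definition vector_marginal :: "('a::euclidean_space \<times> 'b::euclidean_space) measure \<Rightarrow> 'b set \<Rightarrow> 'a"
  where "vector_marginal \<gamma> E = (LINT p : unit_sphere \<times> E | \<gamma>. fst p)"

text \<open>
  The integral of a scalar function against the vector measure \<open>vector_marginal \<gamma>\<close>, written as
  an integral against \<open>\<gamma>\<close>; on indicator functions it gives back \<open>vector_marginal \<gamma>\<close>.
\<close>

definition vector_marginal_integral ::
    "('a::euclidean_space \<times> 'b::euclidean_space) measure \<Rightarrow> ('b \<Rightarrow> real) \<Rightarrow> 'a"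
  where "vector_marginal_integral \<gamma> f = (\<integral>p. f (snd p) *\<^sub>R fst p \<partial>\<gamma>)"

lemma vector_marginal_integral_indicator:
  assumes "space \<gamma> = unit_sphere \<times> unit_sphere"
  shows "vector_marginal_integral \<gamma> (indicator E) = vector_marginal \<gamma> E"
  unfolding vector_marginal_integral_def vector_marginal_def set_lebesgue_integral_def
  using assms by (intro Bochner_Integration.integral_cong) (auto simp: indicator_def)

definition kernel_transform ::
    "(real \<Rightarrow> real) \<Rightarrow> ('a::euclidean_space \<times> 'a) measure \<Rightarrow> 'a \<Rightarrow> 'a"
  where "kernel_transform K \<gamma> z = vector_marginal_integral \<gamma> (\<lambda>\<omega>. K (z \<bullet> \<omega>))"

definition L1_norm :: "'a measure \<Rightarrow> ('a \<Rightarrow> 'b::euclidean_space) \<Rightarrow> real"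
  where "L1_norm M F = (\<integral>x. norm (F x) \<partial>M)"

end

theory Submission imports Defs
begin

text \<open>
  Let \<open>\<psi>\<close> be a primitive of \<open>K\<close>. It is strictly convex, so
  \<open>K t * s \<le> \<psi> s + (t * K t - \<psi> t)\<close> with equality only for \<open>s = t\<close>. Let \<open>F\<close> be the kernel
  transform of \<open>\<gamma>\<close> and \<open>e z\<close> a unit vector with \<open>F z \<bullet> e z = norm (F z)\<close>. Its \<open>L\<^sup>1\<close> norm is the
  integral of \<open>K (z \<bullet> \<omega>) * (x \<bullet> e z)\<close> over \<open>z\<close> and \<open>(x, \<omega>)\<close>; apply the inequality with
  \<open>t = z \<bullet> \<omega>\<close> and \<open>s = x \<bullet> e z\<close>. By rotation invariance of the surface measure the two
  \<open>\<psi>\<close> terms have the same mean, and \<open>t * K t\<close> has mean \<open>\<kappa>\<^sub>1\<close>. Equality forces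
  \<open>x \<bullet> e z = z \<bullet> \<omega>\<close> almost everywhere, so \<open>\<omega>\<close> is a linear function of \<open>x\<close>, and this function
  maps the sphere to itself.
\<close>

section \<open>Orthogonal invariance and full support of the surface measure\<close>

text \<open>
  The library proves this only over well-ordered index types. Here it follows as in the uniqueness
  of Haar measure: \<open>\<nu>\<close> is translation invariant and agrees with \<open>lborel\<close> on the unit ball.
\<close>

lemma lborel_distr_orthogonal:
  fixes f :: "'a::euclidean_space \<Rightarrow> 'a"
  assumes f: "orthogonal_transformation f"
  shows "distr lborel borel f = lborel"
proof -
  define \<nu> where "\<nu> = distr lborel borel f"
  have lin: "linear f"
    using f by (rule orthogonal_transformation_linear)
  then have fm [measurable]: "f \<in> borel_measurable borel"
    by (intro borel_measurable_continuous_onI linear_continuous_on linear_conv_bounded_linear[THEN iffD1])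
  have surj: "surj f"
    using f by (rule orthogonal_transformation_surj)
  have sets_\<nu> [simp, measurable_cong]: "sets \<nu> = sets borel"
    by (simp add: \<nu>_def)
  have ball: "emeasure \<nu> (ball 0 r) = emeasure lborel (ball (0::'a) r)" for r
  proof -
    have "f -` ball 0 r = ball 0 r"
      by (auto simp: orthogonal_transformation_norm[OF f])
    then show ?thesis
      by (simp add: \<nu>_def emeasure_distr)
  qed
  have trans: "(\<integral>\<^sup>+x. h (x + y) \<partial>\<nu>) = (\<integral>\<^sup>+x. h x \<partial>\<nu>)"
    if [measurable]: "h \<in> borel_measurable borel" for h and y
  proof -
    \<comment> \<open>Since \<open>f\<close> is linear, translating \<open>\<nu>\<close> by
      \<open>f y'\<close> is the image under \<open>f\<close> of translating \<open>lborel\<close>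
      by \<open>y'\<close>.\<close>
    obtain y' where y: "y = f y'"
      using surj by (metis surjD)
    have "(\<integral>\<^sup>+x. h (x + y) \<partial>\<nu>) = (\<integral>\<^sup>+x. h (f (y' + x)) \<partial>lborel)"
      by (simp add: \<nu>_def nn_integral_distr y linear_add[OF lin] add.commute)
    also have "\<dots> = (\<integral>\<^sup>+x. h (f x) \<partial>distr lborel borel ((+) y'))"
      by (subst nn_integral_distr) auto
    also have "\<dots> = (\<integral>\<^sup>+x. h x \<partial>\<nu>)"
      by (simp add: lborel_distr_plus \<nu>_def nn_integral_distr)
    finally show ?thesis .
  qed
  have transl: "(\<integral>\<^sup>+x. h (x + y) \<partial>lborel) = (\<integral>\<^sup>+x. h x \<partial>lborel)"
    if [measurable]: "h \<in> borel_measurable borel" for h and y :: 'a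
  proof -
    have "(\<integral>\<^sup>+x. h x \<partial>lborel) = (\<integral>\<^sup>+x. h x \<partial>distr lborel borel ((+) y))"
      by (simp add: lborel_distr_plus)
    also have "\<dots> = (\<integral>\<^sup>+x. h (x + y) \<partial>lborel)"
      by (subst nn_integral_distr) (auto simp: add.commute)
    finally show ?thesis ..
  qed
  \<comment> \<open>Needed for the exchanges of integrals below.\<close>
  interpret \<nu>: sigma_finite_measure \<nu>
  proof
    let ?A = "range (\<lambda>n. ball (0::'a) (real n))"
    have "\<Union>?A = space \<nu>"
      by (auto simp: \<nu>_def intro: reals_Archimedean2)
    then show "\<exists>A. countable A \<and> A \<subseteq> sets \<nu> \<and> \<Union>A = space \<nu> \<and> (\<forall>a\<in>A. emeasure \<nu> a \<noteq> \<infinity>)"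
      by (intro exI[of _ ?A])
        (use less_imp_neq[OF emeasure_lborel_ball_finite[of "0::'a"]] in \<open>auto simp: ball\<close>)
  qed
  interpret pair_sigma_finite lborel \<nu> ..
  let ?B = "ball (0::'a) 1"
  have [measurable]: "?B \<in> sets borel"
    by simp
  have "emeasure \<nu> A = emeasure lborel A" if A [measurable]: "A \<in> sets borel" for A
  proof -
    \<comment> \<open>The double integral of \<open>indicator A x * indicator ?B (y - x)\<close> is
      evaluated in both orders: directly, and after shifting \<open>x\<close> by \<open>y\<close>
      under \<open>\<nu>\<close>. This separates \<open>A\<close> from the ball, whose two measures
      agree and cancel.\<close>
    have "emeasure lborel ?B * emeasure \<nu> A
        = (\<integral>\<^sup>+x. indicator A x * (\<integral>\<^sup>+y. indicator ?B y \<partial>lborel) \<partial>\<nu>)"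
      by (simp add: nn_integral_multc mult.commute)
    also have "\<dots> = (\<integral>\<^sup>+x. indicator A x * (\<integral>\<^sup>+y. indicator ?B (y + - x) \<partial>lborel) \<partial>\<nu>)"
      by (intro nn_integral_cong arg_cong2[where f = "(*)"] refl transl[symmetric]
          borel_measurable_indicator) auto
    also have "\<dots> = (\<integral>\<^sup>+x. \<integral>\<^sup>+y. indicator A x * indicator ?B (y - x) \<partial>lborel \<partial>\<nu>)"
      by (subst nn_integral_cmult) auto
    also have "\<dots> = (\<integral>\<^sup>+y. \<integral>\<^sup>+x. indicator A x * indicator ?B (y - x) \<partial>\<nu> \<partial>lborel)"
      by (rule Fubini') measurable
    also have "\<dots> = (\<integral>\<^sup>+y. \<integral>\<^sup>+x. indicator A (x + y) * indicator ?B (y - (x + y)) \<partial>\<nu> \<partial>lborel)"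
      by (intro nn_integral_cong trans[symmetric]) measurable
    \<comment> \<open>The argument of the second indicator is \<open>- x\<close>, and the ball is
      symmetric about the origin.\<close>
    also have "\<dots> = (\<integral>\<^sup>+y. \<integral>\<^sup>+x. indicator A (x + y) * indicator ?B x \<partial>\<nu> \<partial>lborel)"
      by (auto intro!: nn_integral_cong simp: indicator_def)
    also have "\<dots> = (\<integral>\<^sup>+x. \<integral>\<^sup>+y. indicator A (x + y) * indicator ?B x \<partial>lborel \<partial>\<nu>)"
      by (rule Fubini'[symmetric]) measurable
    also have "\<dots> = (\<integral>\<^sup>+x. (\<integral>\<^sup>+y. indicator A (y + x) \<partial>lborel) * indicator ?B x \<partial>\<nu>)"
      by (subst nn_integral_multc) (auto simp: add.commute)
    also have "\<dots> = (\<integral>\<^sup>+x. emeasure lborel A * indicator ?B x \<partial>\<nu>)"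
      by (simp add: transl[of "indicator A"])
    also have "\<dots> = emeasure lborel A * emeasure \<nu> ?B"
      by (simp add: nn_integral_cmult)
    finally have "emeasure lborel ?B * emeasure \<nu> A = emeasure lborel ?B * emeasure lborel A"
      by (simp add: ball mult.commute)
    moreover have "emeasure lborel ?B \<noteq> 0" "emeasure lborel ?B \<noteq> \<infinity>"
      using emeasure_lborel_ball_finite[of "0::'a" 1] content_ball_pos[of 1 "0::'a"]
      by (auto simp: measure_def)
    ultimately show ?thesis
      by (simp add: ennreal_mult_cancel_left)
  qed
  then show ?thesis
    by (intro measure_eqI) (auto simp: \<nu>_def)
qed

lemma measurable_orthogonal_transformation_sphere:
  fixes f :: "'a::euclidean_space \<Rightarrow> 'a"
  assumes f: "orthogonal_transformation f"
  shows "f \<in> sphere_measure \<rightarrow>\<^sub>M sphere_borel"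
proof -
  have "f \<in> borel_measurable borel"
    using orthogonal_transformation_linear[OF f]
    by (intro borel_measurable_continuous_onI linear_continuous_on linear_conv_bounded_linear[THEN iffD1])
  then have "f \<in> sphere_borel \<rightarrow>\<^sub>M sphere_borel"
    by (intro measurable_restrict_space2 measurable_restrict_space1)
      (auto simp: orthogonal_transformation_norm[OF f] space_restrict_space)
  then show ?thesis
    by (simp cong: measurable_cong_sets)
qed

text \<open>An orthogonal map preserves norms and commutes with scaling, so the cone over a preimage
  is the preimage of the cone. This reduces the claim to invariance of Lebesgue measure.\<close>

lemma sphere_measure_distr_orthogonal:
  fixes f :: "'a::euclidean_space \<Rightarrow> 'a"
  assumes f: "orthogonal_transformation f"
  shows "distr sphere_measure sphere_borel f = sphere_measure"
proof (rule measure_eqI)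
  have lin: "linear f"
    using f by (rule orthogonal_transformation_linear)
  then have fm [measurable]: "f \<in> borel_measurable borel"
    by (intro borel_measurable_continuous_onI linear_continuous_on linear_conv_bounded_linear[THEN iffD1])
  fix E :: "'a set"
  assume "E \<in> sets (distr sphere_measure sphere_borel f)"
  then have E [measurable]: "E \<in> sets borel" and sub: "E \<subseteq> unit_sphere"
    by (auto simp: sets_restrict_space_iff)
  let ?C = "\<lambda>E. {x \<in> ball (0::'a) 1 - {0}. x /\<^sub>R norm x \<in> E}"
  have [measurable]: "f -` E \<in> sets borel"
    using measurable_sets[OF fm E] by simp
  have "emeasure (distr sphere_measure sphere_borel f) E = emeasure sphere_measure (f -` E)"
    using E sub measurable_orthogonal_transformation_sphere[OF f]
    by (subst emeasure_distr)
      (auto simp: sets_restrict_space_iff orthogonal_transformation_norm[OF f]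
        intro!: arg_cong2[where f = emeasure])
  also have "\<dots> = emeasure lborel (?C (f -` E)) / emeasure lborel (ball (0::'a) 1)"
    using sub by (intro emeasure_sphere_measure) (auto simp: orthogonal_transformation_norm[OF f])
  also have "?C (f -` E) = f -` ?C E"
  proof -
    have "f x = 0 \<longleftrightarrow> x = 0" for x
      by (metis orthogonal_transformation_norm[OF f] norm_eq_zero)
    then show ?thesis
      by (simp add: set_eq_iff orthogonal_transformation_norm[OF f] linear_scale[OF lin])
  qed
  also have "emeasure lborel (f -` ?C E) = emeasure (distr lborel borel f) (?C E)"
    by (subst emeasure_distr) auto
  also have "\<dots> / emeasure lborel (ball (0::'a) 1) = emeasure sphere_measure E"
    using E sub by (simp add: lborel_distr_orthogonal[OF f] emeasure_sphere_measure)
  finally show "emeasure (distr sphere_measure sphere_borel f) E = emeasure sphere_measure E" .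
qed simp

text \<open>Full support: the cone over the part of the sphere outside \<open>C\<close> is open, and
  a null open set is empty. It upgrades closed conditions from almost every point to every
  point.\<close>

lemma AE_sphere_measure_closed:
  fixes C :: "'a::euclidean_space set"
  assumes C: "closed C" and ae: "AE x in sphere_measure. x \<in> C"
  shows "unit_sphere \<subseteq> C"
proof (rule ccontr)
  assume "\<not> unit_sphere \<subseteq> C"
  then obtain z where "z \<in> unit_sphere" "z \<notin> C"
    by blast
  then have z: "norm z = 1" "z \<notin> C"
    by auto
  let ?E = "unit_sphere - C"
  let ?U = "{x \<in> ball (0::'a) 1 - {0}. x /\<^sub>R norm x \<in> ?E}"
  have E [measurable]: "?E \<in> sets borel"
    using C by auto
  have U_eq: "?U = (ball 0 1 - {0}) \<inter> (\<lambda>x. x /\<^sub>R norm x) -` (- C)"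
    by auto
  have "open ?U"
    unfolding U_eq using C by (intro continuous_open_preimage continuous_intros open_ball open_Diff) auto
  have "emeasure sphere_measure ?E = 0"
    using ae E by (subst (asm) AE_iff_measurable[OF _ refl])
      (auto simp: sets_restrict_space_iff set_diff_eq)
  then have "emeasure lborel ?U = 0"
    using less_imp_neq[OF emeasure_lborel_ball_finite[of "0::'a" 1]]
    by (simp add: emeasure_sphere_measure[OF E] ennreal_divide_eq_0_iff)
  moreover have "?U \<in> sets borel"
    using \<open>open ?U\<close> by auto
  ultimately have "?U \<in> null_sets lborel"
    by (auto simp: null_sets_def)
  then have "negligible ?U"
    by (simp add: negligible_iff_null_sets null_sets_completionI)
  then have "?U = {}"
    using open_not_negligible[OF \<open>open ?U\<close>] by blast
  \<comment> \<open>Halving moves \<open>z\<close> into the open ball without changing its radial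
    projection.\<close>
  moreover have "(1/2) *\<^sub>R z \<in> ?U"
    using z by auto
  ultimately show False
    by blast
qed

text \<open>Some orthogonal map takes \<open>u\<close> to \<open>v\<close>, so the mean of a zonal
  function does not depend on its pole.\<close>

lemma integral_sphere_measure_inner:
  fixes u v :: "real ^ 'n" and h :: "real \<Rightarrow> real"
  assumes h [measurable]: "h \<in> borel_measurable borel" and "norm u = 1" "norm v = 1"
  shows "(\<integral>x. h (x \<bullet> u) \<partial>sphere_measure) = (\<integral>x. h (x \<bullet> v) \<partial>sphere_measure)"
proof -
  obtain f where f: "orthogonal_transformation f" "f u = v"
    using orthogonal_transformation_exists[of u v] assms by auto
  have "(\<integral>x. h (x \<bullet> v) \<partial>sphere_measure) = (\<integral>x. h (x \<bullet> v) \<partial>distr sphere_measure sphere_borel f)"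
    by (simp add: sphere_measure_distr_orthogonal[OF f(1)])
  also have "\<dots> = (\<integral>x. h (f x \<bullet> f u) \<partial>sphere_measure)"
    using measurable_orthogonal_transformation_sphere[OF f(1)] f(2)
    by (subst integral_distr) (auto intro!: measurable_restrict_space1)
  also have "\<dots> = (\<integral>x. h (x \<bullet> u) \<partial>sphere_measure)"
    using f(1) by (simp add: orthogonal_transformation_def)
  finally show ?thesis ..
qed

section \<open>Tangent inequality for the primitive of the kernel\<close>

text \<open>By the mean value theorem the chord slope is \<open>K\<close> at a point strictly
  between \<open>s\<close> and \<open>t\<close>, which strict monotonicity compares with
  \<open>K t\<close>.\<close>

lemma strict_mono_on_antiderivative:
  fixes K :: "real \<Rightarrow> real"
  assumes cont: "continuous_on {a..b} K" and mono: "strict_mono_on {a..b} K"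
  obtains \<psi> where "continuous_on {a..b} \<psi>"
    and "\<And>s t. s \<in> {a..b} \<Longrightarrow> t \<in> {a..b} \<Longrightarrow> s \<noteq> t \<Longrightarrow> K t * (s - t) < \<psi> s - \<psi> t"
proof -
  obtain \<psi> where \<psi>: "(\<psi> has_vector_derivative K x) (at x within {a..b})" if "x \<in> {a..b}" for x
    using antiderivative_continuous[OF cont] by metis
  have mvt: "\<exists>\<xi>\<in>{s<..<t}. \<psi> t - \<psi> s = (t - s) * K \<xi>" if "a \<le> s" "s < t" "t \<le> b" for s t
  proof -
    have "(\<psi> has_derivative (\<lambda>h. h * K x)) (at x within {s..t})" if "s \<le> x" "x \<le> t" for x
    proof (rule has_derivative_subset)
      show "(\<psi> has_derivative (\<lambda>h. h * K x)) (at x within {a..b})"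
        using \<psi>[of x] that \<open>a \<le> s\<close> \<open>t \<le> b\<close> by (simp add: has_vector_derivative_def)
    qed (use \<open>a \<le> s\<close> \<open>t \<le> b\<close> in auto)
    then show ?thesis
      using mvt_simple[OF \<open>s < t\<close>, of \<psi> "\<lambda>x h. h * K x"] by simp
  qed
  show thesis
  proof
    show "continuous_on {a..b} \<psi>"
      using \<psi> by (intro continuous_on_vector_derivative)
    fix s t
    assume st: "s \<in> {a..b}" "t \<in> {a..b}" "s \<noteq> t"
    show "K t * (s - t) < \<psi> s - \<psi> t"
    proof (cases "s < t")
      case True
      then obtain \<xi> where \<xi>: "\<xi> \<in> {s<..<t}" "\<psi> t - \<psi> s = (t - s) * K \<xi>"
        using mvt[of s t] st by auto
      then have "K \<xi> < K t"
        using st strict_mono_onD[OF mono, of \<xi> t] by auto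
      then show ?thesis
        using \<xi> True mult_strict_left_mono[of "K \<xi>" "K t" "t - s"] by (simp add: algebra_simps)
    next
      case False
      then obtain \<xi> where \<xi>: "\<xi> \<in> {t<..<s}" "\<psi> s - \<psi> t = (s - t) * K \<xi>"
        using mvt[of t s] st by auto
      then have "K t < K \<xi>"
        using st strict_mono_onD[OF mono, of t \<xi>] by auto
      then show ?thesis
        using \<xi> mult_strict_left_mono[of "K t" "K \<xi>" "s - t"] by (simp add: algebra_simps)
    qed
  qed
qed

lemma bounded_inner_sphere:
  fixes h :: "real \<Rightarrow> real"
  assumes "continuous_on UNIV h"
  shows "\<exists>B. \<forall>x y :: 'a::euclidean_space. norm x = 1 \<longrightarrow> norm y = 1 \<longrightarrow> \<bar>h (x \<bullet> y)\<bar> \<le> B"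
proof -
  have "compact (h ` {-1..1})"
    using assms by (intro compact_continuous_image) (auto intro: continuous_on_subset)
  then obtain B where B: "\<And>t. t \<in> {-1..1} \<Longrightarrow> \<bar>h t\<bar> \<le> B"
    by (metis bounded_iff compact_imp_bounded imageI real_norm_def)
  have "\<bar>h (x \<bullet> y)\<bar> \<le> B" if "norm x = 1" "norm y = 1" for x y :: 'a
    using Cauchy_Schwarz_ineq2[of x y] that by (intro B) auto
  then show ?thesis
    by blast
qed

section \<open>The gap of a coupling and the inequality\<close>

text \<open>Continuity on the whole line makes \<open>K\<close> and \<open>\<psi>\<close> Borel
  there; the theorem instantiates both with clamped functions. Monotonicity of the kernel enters
  through \<open>young\<close>.\<close>

locale kernel_coupling =
  fixes K \<psi> :: "real \<Rightarrow> real" and \<kappa> :: real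
    and \<gamma> :: "((real ^ 'n) \<times> (real ^ 'n)) measure"
  assumes K_cont: "continuous_on UNIV K"
    and \<psi>_cont: "continuous_on UNIV \<psi>"
    and young: "\<And>s t. s \<in> {-1..1} \<Longrightarrow> t \<in> {-1..1} \<Longrightarrow> s \<noteq> t \<Longrightarrow> K t * (s - t) < \<psi> s - \<psi> t"
    and multiplier: "\<And>z :: real ^ 'n. z \<in> unit_sphere \<Longrightarrow>
           (\<integral>\<omega>. K (z \<bullet> \<omega>) *\<^sub>R \<omega> \<partial>sphere_measure) = \<kappa> *\<^sub>R z"
    and sets_\<gamma> [measurable_cong]: "sets \<gamma> = sets (restrict_space borel (unit_sphere \<times> unit_sphere))"
    and prob_\<gamma>: "prob_space \<gamma>"
    and marginal: "distr \<gamma> sphere_borel fst = sphere_measure"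
begin

sublocale \<gamma>: prob_space \<gamma>
  by (rule prob_\<gamma>)

sublocale \<mu>: prob_space "sphere_measure :: (real ^ 'n) measure"
  by (rule prob_space_sphere_measure)

sublocale P: pair_prob_space "sphere_measure :: (real ^ 'n) measure" \<gamma> ..

lemma [measurable]: "K \<in> borel_measurable borel" "\<psi> \<in> borel_measurable borel"
  using K_cont \<psi>_cont by (auto intro: borel_measurable_continuous_onI)

lemma space_\<gamma>: "space \<gamma> = unit_sphere \<times> unit_sphere"
  using sets_eq_imp_space_eq[OF sets_\<gamma>] by (simp add: space_restrict_space)

lemma measurable_fst_\<gamma> [measurable]: "fst \<in> borel_measurable \<gamma>"
  and measurable_snd_\<gamma> [measurable]: "snd \<in> borel_measurable \<gamma>"
  by (auto intro!: measurable_restrict_space1 borel_measurable_continuous_onI continuous_intros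
      simp: measurable_cong_sets[OF sets_\<gamma> refl])

lemma measurable_ident_sphere [measurable]: "(\<lambda>x. x) \<in> borel_measurable sphere_measure"
  by (auto intro!: measurable_restrict_space1 cong: measurable_cong_sets)

lemma measurable_fst_sphere: "fst \<in> \<gamma> \<rightarrow>\<^sub>M sphere_borel"
  using measurable_fst_\<gamma> by (auto intro!: measurable_restrict_space2 simp: space_\<gamma>)

text \<open>The unit vector \<open>e z\<close> of the overview. Where the transform vanishes, the
  default \<open>z\<close> keeps the norm equal to one and the choice measurable.\<close>

definition dir :: "real ^ 'n \<Rightarrow> real ^ 'n" where
  "dir z = (let F = kernel_transform K \<gamma> z in if F = 0 then z else F /\<^sub>R norm F)"

lemma norm_dir: "norm z = 1 \<Longrightarrow> norm (dir z) = 1"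
  by (simp add: dir_def Let_def)

lemma measurable_kernel_transform [measurable]:
  "kernel_transform K \<gamma> \<in> borel_measurable sphere_measure"
  unfolding kernel_transform_def vector_marginal_integral_def by measurable

lemma measurable_dir [measurable]: "dir \<in> borel_measurable sphere_measure"
  unfolding dir_def Let_def by measurable

lemma inner_dir: "kernel_transform K \<gamma> z \<bullet> dir z = norm (kernel_transform K \<gamma> z)"
  by (simp add: dir_def Let_def dot_square_norm power2_eq_square)

text \<open>The Bregman divergence of \<open>\<psi>\<close> with slope \<open>K\<close>, from
  \<open>z \<bullet> \<omega>\<close> to \<open>x \<bullet> dir z\<close>: the deficit in the
  tangent inequality.\<close>

definition gap :: "real ^ 'n \<Rightarrow> (real ^ 'n) \<times> (real ^ 'n) \<Rightarrow> real" where
  "gap z p = \<psi> (fst p \<bullet> dir z) - \<psi> (z \<bullet> snd p) - K (z \<bullet> snd p) * (fst p \<bullet> dir z - z \<bullet> snd p)"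

lemma gap_nonneg: "0 \<le> gap z p"
  and gap_eq_0: "gap z p = 0 \<Longrightarrow> fst p \<bullet> dir z = z \<bullet> snd p"
  if "z \<in> unit_sphere" "p \<in> space \<gamma>"
proof -
  have "fst p \<bullet> dir z \<in> {-1..1}" "z \<bullet> snd p \<in> {-1..1}"
    using that Cauchy_Schwarz_ineq2[of "fst p" "dir z"] Cauchy_Schwarz_ineq2[of z "snd p"]
    by (auto simp: space_\<gamma> norm_dir)
  from young[OF this] show "0 \<le> gap z p" "gap z p = 0 \<Longrightarrow> fst p \<bullet> dir z = z \<bullet> snd p"
    by (cases "fst p \<bullet> dir z = z \<bullet> snd p"; simp add: gap_def)+
qed

text \<open>The means of \<open>\<psi> (x \<bullet> dir z)\<close> and \<open>\<psi> (z \<bullet> \<omega>)\<close> cancel by rotation invariance.\<close>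

lemma integral_gap:
  shows integrable_gap: "integrable (sphere_measure \<Otimes>\<^sub>M \<gamma>) (case_prod gap)"
    and "(\<integral>z. \<integral>p. gap z p \<partial>\<gamma> \<partial>sphere_measure) =
      \<kappa> - L1_norm sphere_measure (kernel_transform K \<gamma>)"
proof -
  let ?\<mu> = "sphere_measure :: (real ^ 'n) measure"
  obtain u :: "real ^ 'n" where u: "norm u = 1"
    using vector_choose_size zero_le_one by blast
  \<comment> \<open>The common mean of \<open>\<psi>\<close> over all poles; \<open>u\<close> is an
    arbitrary one.\<close>
  define A where "A = (\<integral>x. \<psi> (x \<bullet> u) \<partial>?\<mu>)"
  obtain BK where BK: "\<And>x y :: real ^ 'n. norm x = 1 \<Longrightarrow> norm y = 1 \<Longrightarrow> \<bar>K (x \<bullet> y)\<bar> \<le> BK"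
    using bounded_inner_sphere[OF K_cont] by blast
  obtain B\<psi> where B\<psi>: "\<And>x y :: real ^ 'n. norm x = 1 \<Longrightarrow> norm y = 1 \<Longrightarrow> \<bar>\<psi> (x \<bullet> y)\<bar> \<le> B\<psi>"
    using bounded_inner_sphere[OF \<psi>_cont] by blast
  have inner: "\<bar>x \<bullet> y\<bar> \<le> 1" if "norm x = 1" "norm y = 1" for x y :: "real ^ 'n"
    using Cauchy_Schwarz_ineq2[of x y] that by simp
  have "0 \<le> BK"
    using BK[OF u u] by linarith
  have bd_mult: "\<bar>K (x \<bullet> y) * r\<bar> \<le> BK" if "norm x = 1" "norm y = 1" "\<bar>r\<bar> \<le> 1"
    for x y :: "real ^ 'n" and r
    using mult_mono[OF BK[OF that(1,2)] that(3)] \<open>0 \<le> BK\<close> by (simp add: abs_mult)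
  \<comment> \<open>The four terms of the expanded \<open>gap\<close>. Each is bounded, so Fubini
    applies to each separately, in whichever order suits it.\<close>
  define f1 f2 f3 f4 :: "real ^ 'n \<Rightarrow> (real ^ 'n) \<times> (real ^ 'n) \<Rightarrow> real"
    where "f1 z p = \<psi> (fst p \<bullet> dir z)" and "f2 z p = \<psi> (z \<bullet> snd p)"
      and "f3 z p = K (z \<bullet> snd p) * (z \<bullet> snd p)"
      and "f4 z p = K (z \<bullet> snd p) * (fst p \<bullet> dir z)" for z p
  have int: "integrable (?\<mu> \<Otimes>\<^sub>M \<gamma>) (case_prod f1)" "integrable (?\<mu> \<Otimes>\<^sub>M \<gamma>) (case_prod f2)"
    "integrable (?\<mu> \<Otimes>\<^sub>M \<gamma>) (case_prod f3)" "integrable (?\<mu> \<Otimes>\<^sub>M \<gamma>) (case_prod f4)"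
    unfolding f1_def f2_def f3_def f4_def case_prod_beta
    by (rule P.integrable_const_bound[of _ B\<psi>] P.integrable_const_bound[of _ BK];
        (measurable | rule AE_I2);
        auto simp: space_pair_measure space_\<gamma> norm_dir intro!: BK B\<psi> bd_mult inner)+
  have gap_eq: "gap = (\<lambda>z p. f1 z p - f2 z p + f3 z p - f4 z p)"
    by (auto simp: fun_eq_iff gap_def f1_def f2_def f3_def f4_def algebra_simps)
  show "integrable (?\<mu> \<Otimes>\<^sub>M \<gamma>) (case_prod gap)"
    using int unfolding gap_eq case_prod_beta by auto
  have "(\<integral>z. \<integral>p. gap z p \<partial>\<gamma> \<partial>?\<mu>) = integral\<^sup>L (?\<mu> \<Otimes>\<^sub>M \<gamma>) (case_prod gap)"
    using P.integral_fst'[OF \<open>integrable (?\<mu> \<Otimes>\<^sub>M \<gamma>) (case_prod gap)\<close>] by simp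
  also have "\<dots> = integral\<^sup>L (?\<mu> \<Otimes>\<^sub>M \<gamma>) (case_prod f1) - integral\<^sup>L (?\<mu> \<Otimes>\<^sub>M \<gamma>) (case_prod f2)
      + integral\<^sup>L (?\<mu> \<Otimes>\<^sub>M \<gamma>) (case_prod f3) - integral\<^sup>L (?\<mu> \<Otimes>\<^sub>M \<gamma>) (case_prod f4)"
    using int unfolding gap_eq case_prod_beta by simp
  \<comment> \<open>For fixed \<open>z\<close> the integrand depends on \<open>p\<close> only
    through \<open>fst p\<close>, whose law is the surface measure.\<close>
  also have "integral\<^sup>L (?\<mu> \<Otimes>\<^sub>M \<gamma>) (case_prod f1) = A"
  proof -
    have "(\<integral>p. f1 z p \<partial>\<gamma>) = A" if "z \<in> unit_sphere" for z
    proof -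
      have "(\<integral>p. f1 z p \<partial>\<gamma>) = (\<integral>x. \<psi> (x \<bullet> dir z) \<partial>distr \<gamma> sphere_borel fst)"
        unfolding f1_def by (subst integral_distr[OF measurable_fst_sphere])
          (auto intro!: measurable_restrict_space1)
      also have "\<dots> = A"
        unfolding marginal A_def using that
        by (intro integral_sphere_measure_inner u) (auto simp: norm_dir)
      finally show ?thesis .
    qed
    then have "(\<integral>z. \<integral>p. f1 z p \<partial>\<gamma> \<partial>?\<mu>) = (\<integral>z. A \<partial>?\<mu>)"
      by (intro Bochner_Integration.integral_cong) auto
    then show ?thesis
      using P.integral_fst'[OF int(1)] by (simp add: \<mu>.prob_space[simplified])
  qed
  \<comment> \<open>Here \<open>z\<close> is integrated first, with pole
    \<open>snd p\<close>.\<close>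
  also have "integral\<^sup>L (?\<mu> \<Otimes>\<^sub>M \<gamma>) (case_prod f2) = A"
  proof -
    have "(\<integral>z. f2 z p \<partial>?\<mu>) = A" if "p \<in> space \<gamma>" for p
      unfolding f2_def A_def using that
      by (intro integral_sphere_measure_inner u) (auto simp: space_\<gamma>)
    then have "(\<integral>p. \<integral>z. f2 z p \<partial>?\<mu> \<partial>\<gamma>) = (\<integral>p. A \<partial>\<gamma>)"
      by (intro Bochner_Integration.integral_cong) auto
    then show ?thesis
      using P.integral_snd[OF int(2)] by (simp add: \<gamma>.prob_space)
  qed
  \<comment> \<open>The multiplier identity at the unit vector \<open>snd p\<close>, paired with
    that same vector.\<close>
  also have "integral\<^sup>L (?\<mu> \<Otimes>\<^sub>M \<gamma>) (case_prod f3) = \<kappa>"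
  proof -
    have "(\<integral>z. f3 z p \<partial>?\<mu>) = \<kappa>" if "p \<in> space \<gamma>" for p
    proof -
      let ?w = "snd p"
      have w: "norm ?w = 1"
        using that by (auto simp: space_\<gamma>)
      have "integrable ?\<mu> (\<lambda>z. K (?w \<bullet> z) *\<^sub>R z)"
        using BK[OF w] by (intro \<mu>.integrable_const_bound[of _ BK] AE_I2) auto
      then have "(\<integral>z. ?w \<bullet> (K (?w \<bullet> z) *\<^sub>R z) \<partial>?\<mu>) = ?w \<bullet> (\<kappa> *\<^sub>R ?w)"
        using multiplier[of ?w] w by (subst integral_inner_right) auto
      then show ?thesis
        using w by (simp add: f3_def inner_commute dot_square_norm)
    qed
    then have "(\<integral>p. \<integral>z. f3 z p \<partial>?\<mu> \<partial>\<gamma>) = (\<integral>p. \<kappa> \<partial>\<gamma>)"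
      by (intro Bochner_Integration.integral_cong) auto
    then show ?thesis
      using P.integral_snd[OF int(3)] by (simp add: \<gamma>.prob_space)
  qed
  also have "integral\<^sup>L (?\<mu> \<Otimes>\<^sub>M \<gamma>) (case_prod f4) = L1_norm ?\<mu> (kernel_transform K \<gamma>)"
  proof -
    have "(\<integral>p. f4 z p \<partial>\<gamma>) = norm (kernel_transform K \<gamma> z)" if "z \<in> unit_sphere" for z
    proof -
      have "integrable \<gamma> (\<lambda>p. K (z \<bullet> snd p) *\<^sub>R fst p)"
        using BK[of z] that by (intro \<gamma>.integrable_const_bound[of _ BK] AE_I2) (auto simp: space_\<gamma>)
      then have "(\<integral>p. (K (z \<bullet> snd p) *\<^sub>R fst p) \<bullet> dir z \<partial>\<gamma>) = kernel_transform K \<gamma> z \<bullet> dir z"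
        unfolding kernel_transform_def vector_marginal_integral_def by (rule integral_inner_left)
      then show ?thesis
        by (simp add: f4_def inner_dir)
    qed
    then have "(\<integral>z. \<integral>p. f4 z p \<partial>\<gamma> \<partial>?\<mu>) = L1_norm ?\<mu> (kernel_transform K \<gamma>)"
      unfolding L1_norm_def by (intro Bochner_Integration.integral_cong) auto
    then show ?thesis
      using P.integral_fst'[OF int(4)] by simp
  qed
  finally show "(\<integral>z. \<integral>p. gap z p \<partial>\<gamma> \<partial>?\<mu>) = \<kappa> - L1_norm ?\<mu> (kernel_transform K \<gamma>)"
    by simp
qed

lemma integral_gap_nonneg: "z \<in> unit_sphere \<Longrightarrow> 0 \<le> (\<integral>p. gap z p \<partial>\<gamma>)"
  by (intro Bochner_Integration.integral_nonneg gap_nonneg)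

lemma L1_norm_kernel_transform_le: "L1_norm sphere_measure (kernel_transform K \<gamma>) \<le> \<kappa>"
proof -
  have "0 \<le> (\<integral>z. \<integral>p. gap z p \<partial>\<gamma> \<partial>sphere_measure)"
    by (intro Bochner_Integration.integral_nonneg integral_gap_nonneg) simp
  then show ?thesis
    by (simp add: integral_gap)
qed

section \<open>The equality case\<close>

text \<open>At equality the nonnegative \<open>gap\<close> has mean zero. Its inner integrals vanish
  for almost every \<open>z\<close>, and then \<open>gap z\<close> itself vanishes almost
  everywhere.\<close>

lemma AE_dir:
  assumes "L1_norm sphere_measure (kernel_transform K \<gamma>) = \<kappa>"
  shows "AE z in sphere_measure. AE p in \<gamma>. fst p \<bullet> dir z = z \<bullet> snd p"
proof -
  have "(\<integral>z. \<integral>p. gap z p \<partial>\<gamma> \<partial>sphere_measure) = 0"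
    using assms by (simp add: integral_gap)
  moreover have "AE z in sphere_measure. 0 \<le> (\<integral>p. gap z p \<partial>\<gamma>)"
    by (rule AE_I2) (simp add: integral_gap_nonneg)
  ultimately have "AE z in sphere_measure. (\<integral>p. gap z p \<partial>\<gamma>) = 0"
    using P.integrable_fst'[OF integrable_gap] by (subst (asm) integral_nonneg_eq_0_iff_AE) auto
  \<comment> \<open>A non-integrable slice would have integral zero by convention, so integrability
    must be known before concluding that the slice vanishes.\<close>
  moreover have "AE z in sphere_measure. integrable \<gamma> (gap z)"
    using P.AE_integrable_fst'[OF integrable_gap] by simp
  ultimately show ?thesis
    using AE_space
  proof eventually_elim
    case (elim z)
    have nonneg: "AE p in \<gamma>. 0 \<le> gap z p"
      using elim by (intro AE_I2 gap_nonneg) auto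
    have "AE p in \<gamma>. gap z p = 0"
      using elim integral_nonneg_eq_0_iff_AE[OF _ nonneg] by simp
    then show ?case
      using AE_space by eventually_elim (use elim gap_eq_0 in auto)
  qed
qed

text \<open>
  The identity \<open>x \<bullet> dir z = z \<bullet> \<omega>\<close> for \<open>z\<close> in a basis already makes \<open>\<omega>\<close> a linear function of \<open>x\<close>.
\<close>

lemma ex_linear:
  assumes "L1_norm sphere_measure (kernel_transform K \<gamma>) = \<kappa>"
  obtains f where "linear f" "AE p in \<gamma>. snd p = f (fst p)"
proof -
  define G where "G = {z \<in> unit_sphere. AE p in \<gamma>. fst p \<bullet> dir z = z \<bullet> snd p}"
  \<comment> \<open>A subspace is closed, so by full support \<open>span G\<close> contains the
    sphere, and the good points \<open>G\<close> contain a basis of the space.\<close>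
  have "AE z in sphere_measure. z \<in> span G"
    using AE_dir[OF assms] AE_space by eventually_elim (auto simp: G_def intro: span_base)
  then have sphere: "unit_sphere \<subseteq> span G"
    by (intro AE_sphere_measure_closed closed_span)
  obtain B where B: "B \<subseteq> G" "independent B" "G \<subseteq> span B"
    using maximal_independent_subset[of G] by blast
  have in_span: "z \<in> span B" for z
  proof (cases "z = 0")
    case False
    then have "z /\<^sub>R norm z \<in> span B"
      using sphere span_mono[OF B(3)] by (force simp: span_span)
    then have "norm z *\<^sub>R (z /\<^sub>R norm z) \<in> span B"
      by (rule span_scale)
    then show ?thesis
      using False by simp
  qed (simp add: span_zero)
  \<comment> \<open>The linear map \<open>g\<close> is only required to match \<open>dir\<close> on
    the basis; its adjoint will carry \<open>x\<close> to \<open>\<omega>\<close>.\<close>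
  obtain g where g: "linear g" "\<And>b. b \<in> B \<Longrightarrow> g b = dir b"
    using linear_independent_extend[OF B(2), of dir] by blast
  \<comment> \<open>Countability merges the exceptional null sets of the basis vectors into
    one.\<close>
  have "countable B"
    using B(2) independent_imp_finite countable_finite by blast
  then have "AE p in \<gamma>. \<forall>b\<in>B. fst p \<bullet> dir b = b \<bullet> snd p"
    using B(1) by (auto simp: AE_ball_countable G_def)
  then have "AE p in \<gamma>. snd p = adjoint g (fst p)"
  proof eventually_elim
    case (elim p)
    have "fst p \<bullet> g z = snd p \<bullet> z" for z
    proof (rule linear_eq_on[OF _ _ in_span])
      show "linear (\<lambda>z. fst p \<bullet> g z)"
        using linear_compose[OF g(1), of "\<lambda>y. fst p \<bullet> y"]
        by (simp add: o_def bounded_linear.linear[OF bounded_linear_inner_right])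
      show "linear (\<lambda>z. snd p \<bullet> z)"
        by (simp add: bounded_linear.linear[OF bounded_linear_inner_right])
    qed (use elim g(2) in \<open>auto simp: inner_commute\<close>)
    then have "adjoint g (fst p) \<bullet> z = snd p \<bullet> z" for z
      by (simp add: adjoint_clauses[OF g(1)])
    then show ?case
      by (metis vector_eq_rdot)
  qed
  then show thesis
    using that[OF adjoint_linear[OF g(1)]] by blast
qed

text \<open>Both \<open>x\<close> and \<open>f x = \<omega>\<close> are unit vectors almost surely.
  As \<open>x\<close> has the surface measure as law, full support makes the linear map
  \<open>f\<close> norm-preserving on the whole sphere, hence orthogonal.\<close>

lemma ex_orthogonal_matrix:
  assumes "L1_norm sphere_measure (kernel_transform K \<gamma>) = \<kappa>"
  obtains M where "orthogonal_matrix M"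
    and "\<gamma> = distr sphere_measure (restrict_space borel (unit_sphere \<times> unit_sphere)) (\<lambda>x. (x, M *v x))"
proof -
  obtain f where f: "linear f" and ae: "AE p in \<gamma>. snd p = f (fst p)"
    using ex_linear[OF assms] .
  have f_cont: "continuous_on UNIV f"
    using f by (simp add: linear_continuous_on linear_conv_bounded_linear)
  then have [measurable]: "f \<in> borel_measurable borel"
    by (rule borel_measurable_continuous_onI)
  have "AE x in distr \<gamma> sphere_borel fst. norm (f x) = 1"
  proof (subst AE_distr_iff[OF measurable_fst_sphere])
    show "{x \<in> space sphere_borel. norm (f x) = 1} \<in> sets sphere_borel"
      by (auto simp: sets_restrict_space_iff space_restrict_space)
    show "AE p in \<gamma>. norm (f (fst p)) = 1"
      using ae AE_space by eventually_elim (auto simp: space_\<gamma>)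
  qed
  then have "unit_sphere \<subseteq> {x. norm (f x) = 1}"
    unfolding marginal
    by (intro AE_sphere_measure_closed closed_Collect_eq continuous_intros f_cont) auto
  then have unit: "norm (f x) = 1" if "norm x = 1" for x
    using that by auto
  have "norm (f x) = norm x" for x
  proof (cases "x = 0")
    case False
    then have "norm (f (norm x *\<^sub>R (x /\<^sub>R norm x))) = norm x"
      by (subst linear_scale[OF f]) (simp add: unit)
    then show ?thesis
      using False by simp
  qed (simp add: linear_0[OF f])
  then have orth: "orthogonal_transformation f"
    using f by (simp add: orthogonal_transformation)
  have mat: "matrix f *v x = f x" for x
    using f by (simp add: matrix_works)
  have pair: "(\<lambda>x. (x, f x)) \<in> sphere_borel \<rightarrow>\<^sub>M \<gamma>"
    unfolding measurable_cong_sets[OF refl sets_\<gamma>] using f_cont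
    by (intro measurable_restrict_space2 measurable_restrict_space1 borel_measurable_continuous_onI)
      (auto simp: space_restrict_space unit intro!: continuous_intros)
  show thesis
  proof
    show "orthogonal_matrix (matrix f)"
      using orth by (simp add: orthogonal_transformation_matrix)
    \<comment> \<open>The identity agrees almost surely with a map factoring through
      \<open>fst\<close>, so \<open>\<gamma>\<close> is an image of its first marginal.\<close>
    have "\<gamma> = distr \<gamma> \<gamma> (\<lambda>p. p)"
      by (simp add: distr_id)
    also have "\<dots> = distr \<gamma> \<gamma> ((\<lambda>x. (x, f x)) \<circ> fst)"
      using ae measurable_comp[OF measurable_fst_sphere pair]
      by (intro distr_cong_AE) (auto simp: prod_eq_iff)
    also have "\<dots> = distr sphere_measure \<gamma> (\<lambda>x. (x, f x))"
      by (simp add: distr_distr[OF pair measurable_fst_sphere, symmetric] marginal)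
    also have "\<dots> = distr sphere_measure (restrict_space borel (unit_sphere \<times> unit_sphere))
        (\<lambda>x. (x, matrix f *v x))"
      by (intro distr_cong) (auto simp: sets_\<gamma> mat)
    finally show "\<gamma> = \<dots>" .
  qed
qed

section \<open>Orthogonal graphs attain equality\<close>

text \<open>Moving \<open>M\<close> across the inner product turns the transform at \<open>z\<close>
  into the multiplier identity at \<open>z v* M\<close>, so its norm is constant on the
  sphere.\<close>

lemma L1_norm_kernel_transform_orthogonal:
  assumes M: "orthogonal_matrix M"
    and \<gamma>: "\<gamma> = distr sphere_measure (restrict_space borel (unit_sphere \<times> unit_sphere)) (\<lambda>x. (x, M *v x))"
  shows "L1_norm sphere_measure (kernel_transform K \<gamma>) = \<kappa>"
proof -
  have orth: "norm (M *v x) = norm x" "norm (x v* M) = norm x" for x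
    using M orthogonal_transformation_matrix[of "(*v) M"]
      orthogonal_transformation_matrix[of "(*v) (transpose M)"]
    by (auto simp flip: transpose_matrix_vector intro: orthogonal_transformation_norm)
  have pair: "(\<lambda>x. (x, M *v x)) \<in>
      sphere_measure \<rightarrow>\<^sub>M restrict_space borel (unit_sphere \<times> unit_sphere)"
    unfolding measurable_cong_sets[OF sets_sphere_measure refl]
    by (intro measurable_restrict_space2 measurable_restrict_space1 borel_measurable_continuous_onI)
      (auto simp: space_restrict_space orth intro!: continuous_intros)
  have "norm (kernel_transform K \<gamma> z) = \<kappa>" if z: "z \<in> unit_sphere" for z
  proof -
    let ?w = "z v* M"
    have w: "?w \<in> unit_sphere"
      using z by (simp add: orth)
    \<comment> \<open>The sign comes from the inequality already proved, whose left side is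
      nonnegative.\<close>
    have "0 \<le> \<kappa>"
      using L1_norm_kernel_transform_le
      by (rule order_trans[rotated]) (simp add: L1_norm_def)
    have "kernel_transform K \<gamma> z = (\<integral>x. K (z \<bullet> (M *v x)) *\<^sub>R x \<partial>sphere_measure)"
      unfolding kernel_transform_def vector_marginal_integral_def
      by (subst \<gamma>, subst integral_distr[OF pair]) (auto intro!: measurable_restrict_space1)
    also have "\<dots> = \<kappa> *\<^sub>R ?w"
      using multiplier[OF w] by (simp add: dot_lmul_matrix)
    finally show ?thesis
      using w \<open>0 \<le> \<kappa>\<close> by simp
  qed
  then have "L1_norm sphere_measure (kernel_transform K \<gamma>) = (\<integral>z. \<kappa> \<partial>(sphere_measure :: (real ^ 'n) measure))"
    unfolding L1_norm_def by (intro Bochner_Integration.integral_cong) auto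
  then show ?thesis
    by (simp add: \<mu>.prob_space[simplified])
qed

end

section \<open>Passage from kernels on the interval to the locale\<close>

theorem proposition5p1:
  fixes K :: "real \<Rightarrow> real" and \<kappa>\<^sub>1 :: real
    and \<gamma> :: "((real ^ 'n) \<times> (real ^ 'n)) measure"
  assumes dim: "CARD('n) \<ge> 3"
    and K_cont: "continuous_on {-1..1} K"
    and K_nonneg: "\<And>t. t \<in> {-1..1} \<Longrightarrow> 0 \<le> K t"
    and K_mono: "strict_mono_on {-1..1} K"
    and \<kappa>_pos: "\<kappa>\<^sub>1 > 0"
    and \<kappa>_multiplier: "\<And>z :: real ^ 'n. z \<in> unit_sphere \<Longrightarrow>
           (\<integral>\<omega>. K (z \<bullet> \<omega>) *\<^sub>R \<omega> \<partial>sphere_measure) = \<kappa>\<^sub>1 *\<^sub>R z"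
    and \<gamma>_borel: "sets \<gamma> = sets (restrict_space borel (unit_sphere \<times> unit_sphere))"
    and \<gamma>_prob: "prob_space \<gamma>"
    and \<gamma>_marginal: "distr \<gamma> sphere_borel fst = sphere_measure"
  shows "L1_norm sphere_measure (kernel_transform K \<gamma>) \<le> \<kappa>\<^sub>1 \<and>
    (L1_norm sphere_measure (kernel_transform K \<gamma>) = \<kappa>\<^sub>1 \<longleftrightarrow>
      (\<exists>M :: real ^ 'n ^ 'n. orthogonal_matrix M \<and>
        \<gamma> = distr sphere_measure (restrict_space borel (unit_sphere \<times> unit_sphere))
              (\<lambda>x. (x, M *v x))))"
proof -
  interpret \<gamma>: prob_space \<gamma>
    by (rule \<gamma>_prob)
  \<comment> \<open>Clamping extends \<open>K\<close> and \<open>\<psi>\<close> continuously to the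
    line and fixes inner products of unit vectors, so the transform on the sphere is
    unchanged.\<close>
  define c where "c = clamp (-1) (1::real)"
  have c: "c t = t" if "t \<in> {-1..1}" for t
    using that by (simp add: c_def)
  obtain \<psi> where \<psi>: "continuous_on {-1..1} \<psi>"
    and young: "\<And>s t. s \<in> {-1..1} \<Longrightarrow> t \<in> {-1..1} \<Longrightarrow> s \<noteq> t \<Longrightarrow> K t * (s - t) < \<psi> s - \<psi> t"
    using strict_mono_on_antiderivative[OF K_cont K_mono] by blast
  have c_inner: "c (z \<bullet> \<omega>) = z \<bullet> \<omega>" if "norm z = 1" "norm \<omega> = 1" for z \<omega> :: "real ^ 'n"
    using Cauchy_Schwarz_ineq2[of z \<omega>] that by (intro c) auto
  interpret kernel_coupling "\<lambda>t. K (c t)" "\<lambda>t. \<psi> (c t)" \<kappa>\<^sub>1 \<gamma>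
  proof
    show "continuous_on UNIV (\<lambda>t. K (c t))" "continuous_on UNIV (\<lambda>t. \<psi> (c t))"
      unfolding c_def using K_cont \<psi> by (intro clamp_continuous_on; simp)+
    show "K (c t) * (s - t) < \<psi> (c s) - \<psi> (c t)" if "s \<in> {-1..1}" "t \<in> {-1..1}" "s \<noteq> t" for s t
      using young[OF that] that by (simp add: c)
    show "(\<integral>\<omega>. K (c (z \<bullet> \<omega>)) *\<^sub>R \<omega> \<partial>sphere_measure) = \<kappa>\<^sub>1 *\<^sub>R z"
      if z: "z \<in> unit_sphere" for z :: "real ^ 'n"
    proof -
      have "(\<integral>\<omega>. K (c (z \<bullet> \<omega>)) *\<^sub>R \<omega> \<partial>sphere_measure) = (\<integral>\<omega>. K (z \<bullet> \<omega>) *\<^sub>R \<omega> \<partial>sphere_measure)"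
        using z by (intro Bochner_Integration.integral_cong) (auto simp: c_inner)
      then show ?thesis
        using \<kappa>_multiplier[OF z] by simp
    qed
  qed (use \<gamma>_borel \<gamma>_marginal in auto)
  have "kernel_transform (\<lambda>t. K (c t)) \<gamma> z = kernel_transform K \<gamma> z" if "z \<in> unit_sphere" for z
    unfolding kernel_transform_def vector_marginal_integral_def using that
    by (intro Bochner_Integration.integral_cong) (auto simp: space_\<gamma> c_inner)
  then have L1_eq: "L1_norm sphere_measure (kernel_transform (\<lambda>t. K (c t)) \<gamma>) =
      L1_norm sphere_measure (kernel_transform K \<gamma>)"
    unfolding L1_norm_def by (intro Bochner_Integration.integral_cong) auto
  note le = L1_norm_kernel_transform_le[unfolded L1_eq]
    and ex_matrix = ex_orthogonal_matrix[unfolded L1_eq]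
    and orthogonal_eq = L1_norm_kernel_transform_orthogonal[unfolded L1_eq]
  show ?thesis
  proof (intro conjI iffI le)
    assume "L1_norm sphere_measure (kernel_transform K \<gamma>) = \<kappa>\<^sub>1"
    from ex_matrix[OF this]
    show "\<exists>M. orthogonal_matrix M \<and> \<gamma> = distr sphere_measure
        (restrict_space borel (unit_sphere \<times> unit_sphere)) (\<lambda>x. (x, M *v x))"
      by blast
  next
    assume "\<exists>M. orthogonal_matrix M \<and> \<gamma> = distr sphere_measure
        (restrict_space borel (unit_sphere \<times> unit_sphere)) (\<lambda>x. (x, M *v x))"
    then show "L1_norm sphere_measure (kernel_transform K \<gamma>) = \<kappa>\<^sub>1"
      using orthogonal_eq by blast
  qed
qed

end
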